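(* If for $\nu$-a.e. $y$ the component of $\pi_{Y=y}$ absolutely continuous with respect to the Lebesgue measure on $\mathbb{R}$ is non-zero, in particular when $\mathcal{Y}=\mathbb{R}^d$ and $\pi$ has a density with respect to the Lebesgue measure on $\mathbb{R}^{1+d}$, then property $(\mathcal{R}_+)$ does not hold.
   Context: Setting: $\mathcal{Y}$ is a separable Banach space with Borel $\sigma$-algebra $\mathcal{B}(\mathcal{Y})$, and $\pi$ is a probability measure on $\mathbb{R}\times\mathcal{Y}$ (with its Borel $\sigma$-algebra) with first marginal $\mu$ on $\mathbb{R}$ and second marginal $\nu$ on $\mathcal{Y}$. Fix probability kernels $(\pi_{X=x})_{x\in\mathbb{R}}$ (probability measures on $\mathcal{Y}$) and $(\pi_{Y=y})_{y\in\mathcal{Y}}$ (probability measures on $\mathbb{R}$) disintegrating $\pi$: $\pi(dx,dy)=\mu(dx)\,\pi_{X=x}(dy)=\nu(dy)\,\pi_{Y=y}(dx)$. The absolutely continuous component of $\pi_{Y=y}$ is the one given by the Lebesgue decomposition. $L^1_+(\mu)$ denotes the set of non-negative elements of $L^1(\mu)$. Property $(\mathcal{R}_+)$: for every $f\in L^1_+(\mu)$ there exists a measurable $g:\mathcal{Y}\to\mathbb{R}_+=[0,\infty)$ such that $f(x)=\int_{\mathcal{Y}}g(y)\,\pi_{X=x}(dy)$ for $\mu$-a.e. $x$. *)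

theory Defs
  imports "HOL-Probability.Probability"
begin

section \<open>Lebesgue decomposition\<close>

definition mutually_singular :: "'a measure \<Rightarrow> 'a measure \<Rightarrow> bool" where
  "mutually_singular N S \<longleftrightarrow>
     sets S = sets N \<and> (\<exists>Z\<in>sets N. emeasure N Z = 0 \<and> emeasure S (space N - Z) = 0)"

definition lebesgue_decomposition ::
    "'a measure \<Rightarrow> 'a measure \<Rightarrow> 'a measure \<Rightarrow> 'a measure \<Rightarrow> bool" where
  "lebesgue_decomposition N M A S \<longleftrightarrow>
     sets A = sets M \<and> sets S = sets M \<and>
     absolutely_continuous N A \<and> mutually_singular N S \<and>
     (\<forall>B\<in>sets M. emeasure M B = emeasure A B + emeasure S B)"

text \<open>The definite description below is meaningful for finite \<open>M\<close>: see
  \<open>lebesgue_decomposition_ex\<close> and \<open>lebesgue_decomposition_unique\<close>.\<close>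

definition ac_component :: "'a measure \<Rightarrow> 'a measure \<Rightarrow> 'a measure" where
  "ac_component N M = (THE A. \<exists>S. lebesgue_decomposition N M A S)"

lemma lebesgue_decomposition_unique:
  assumes "lebesgue_decomposition N M A S" "lebesgue_decomposition N M A' S'"
  shows "A = A'"
proof -
  have aux: "\<exists>Z\<in>null_sets N. \<forall>B\<in>sets M. emeasure A1 B = emeasure M (B - Z) \<and>
      (\<forall>Y\<in>null_sets N. emeasure A1 B = emeasure M (B - (Z \<union> Y)))"
    if "lebesgue_decomposition N M A1 S1" for A1 S1
  proof -
    from that have s: "sets A1 = sets M" "sets S1 = sets M" "sets S1 = sets N"
      and ac: "null_sets N \<subseteq> null_sets A1"
      and sm: "\<And>B. B \<in> sets M \<Longrightarrow> emeasure M B = emeasure A1 B + emeasure S1 B"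
      by (auto simp: lebesgue_decomposition_def mutually_singular_def absolutely_continuous_def)
    from that obtain Z where Z: "Z \<in> sets N" "emeasure N Z = 0" "emeasure S1 (space N - Z) = 0"
      by (auto simp: lebesgue_decomposition_def mutually_singular_def)
    have key: "emeasure A1 B = emeasure M (B - (Z \<union> Y))" if B: "B \<in> sets M" and Y: "Y \<in> null_sets N" for B Y
    proof -
      have ZY: "Z \<union> Y \<in> null_sets A1"
        using ac Z Y by (intro set_mp[OF ac] null_sets.Un) auto
      have B': "B \<in> sets A1" "B \<in> sets S1" using B s by auto
      have ZYs: "Z \<union> Y \<in> sets M" using Z Y s by auto
      have spN: "space N = space S1" using sets_eq_imp_space_eq[OF s(3)] by simp
      have "emeasure S1 (B - (Z \<union> Y)) \<le> emeasure S1 (space N - Z)"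
        using sets.sets_into_space[OF B'(2)] spN Z s by (intro emeasure_mono) auto
      then have 0: "emeasure S1 (B - (Z \<union> Y)) = 0" using Z by simp
      have "emeasure A1 (B - (Z \<union> Y)) = emeasure A1 B"
        by (rule emeasure_Diff_null_set[OF ZY B'(1)])
      with sm[of "B - (Z \<union> Y)"] 0 B ZYs show ?thesis by auto
    qed
    have "Z \<in> null_sets N" using Z by auto
    then show ?thesis using key[where Y="{}"] key by (intro bexI[of _ Z]) auto
  qed
  obtain Z where Z: "Z \<in> null_sets N"
    "\<And>B Y. B \<in> sets M \<Longrightarrow> Y \<in> null_sets N \<Longrightarrow> emeasure A B = emeasure M (B - (Z \<union> Y))"
    using aux[OF assms(1)] by blast
  obtain Z' where Z': "Z' \<in> null_sets N"
    "\<And>B Y. B \<in> sets M \<Longrightarrow> Y \<in> null_sets N \<Longrightarrow> emeasure A' B = emeasure M (B - (Z' \<union> Y))"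
    using aux[OF assms(2)] by blast
  have "sets A = sets M" "sets A' = sets M"
    using assms by (auto simp: lebesgue_decomposition_def)
  then show ?thesis
    using Z(2)[OF _ Z'(1)] Z'(2)[OF _ Z(1)]
    by (intro measure_eqI) (auto simp: Un_commute)
qed

lemma lebesgue_decomposition_ex:
  assumes "finite_measure M" and s: "sets N = sets M"
  shows "\<exists>A S. lebesgue_decomposition N M A S"
proof -
  interpret finite_measure M by fact
  let ?c = "SUP Z\<in>null_sets N. emeasure M Z"
  have "emeasure M ` null_sets N \<noteq> {}" by auto
  from ennreal_Sup_countable_SUP[OF this]
  obtain h :: "nat \<Rightarrow> ennreal" where h: "range h \<subseteq> emeasure M ` null_sets N" "?c = (SUP i. h i)"
    by blast
  have "\<forall>i. \<exists>Z. Z \<in> null_sets N \<and> h i = emeasure M Z" using h(1) by blast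
  then obtain Zs where Zs: "\<And>i. Zs i \<in> null_sets N" "\<And>i. h i = emeasure M (Zs i)" by metis
  define Z where "Z = (\<Union>i. Zs i)"
  have Z: "Z \<in> null_sets N" unfolding Z_def using Zs by blast
  then have ZM: "Z \<in> sets M" using s by auto
  have cZ: "?c \<le> emeasure M Z"
    unfolding h(2) Zs(2) Z_def using ZM unfolding Z_def by (intro SUP_least emeasure_mono) auto
  have max: "emeasure M (B - Z) = 0" if B: "B \<in> null_sets N" for B
  proof -
    have BM: "B \<in> sets M" using B s by auto
    have "emeasure M Z + emeasure M (B - Z) = emeasure M (Z \<union> B)"
      using ZM BM by (subst plus_emeasure) auto
    also have "\<dots> \<le> ?c" using Z B by (intro SUP_upper) auto
    also have "\<dots> \<le> emeasure M Z" by (rule cZ)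
    finally have "emeasure M Z + emeasure M (B - Z) \<le> emeasure M Z + 0" by simp
    then have "emeasure M (B - Z) \<le> 0"
      using emeasure_finite[of Z] unfolding ennreal_add_left_cancel_le by simp
    then show ?thesis by simp
  qed
  define A where "A = density M (indicator (space M - Z))"
  define S where "S = density M (indicator Z)"
  have A: "emeasure A B = emeasure M (B - Z)" if "B \<in> sets M" for B
  proof -
    have "emeasure A B = emeasure M ((space M - Z) \<inter> B)"
      unfolding A_def using ZM that by (intro emeasure_restricted) simp_all
    also have "(space M - Z) \<inter> B = B - Z" using sets.sets_into_space[OF that] by auto
    finally show ?thesis .
  qed
  have S: "emeasure S B = emeasure M (Z \<inter> B)" if "B \<in> sets M" for B
    unfolding S_def using ZM that by (rule emeasure_restricted)
  have "lebesgue_decomposition N M A S"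
    unfolding lebesgue_decomposition_def
  proof (intro conjI ballI)
    show "sets A = sets M" "sets S = sets M" by (simp_all add: A_def S_def)
    show "absolutely_continuous N A"
      unfolding absolutely_continuous_def
    proof
      fix B assume B: "B \<in> null_sets N"
      then have "B \<in> sets M" using s by auto
      then show "B \<in> null_sets A"
        using A max[OF B] by (intro null_setsI) (simp_all add: A_def)
    qed
    have "sets S = sets N" using s by (simp add: S_def)
    moreover have "emeasure S (space N - Z) = 0"
      using S[of "space N - Z"] ZM sets_eq_imp_space_eq[OF s] by auto
    ultimately show "mutually_singular N S"
      unfolding mutually_singular_def using Z by auto
    fix B assume B: "B \<in> sets M"
    have "emeasure M B = emeasure M ((B - Z) \<union> (Z \<inter> B))"
      by (rule arg_cong[where f="emeasure M"]) auto
    also have "\<dots> = emeasure A B + emeasure S B"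
      using B ZM by (subst plus_emeasure[symmetric]) (auto simp: A S)
    finally show "emeasure M B = emeasure A B + emeasure S B" .
  qed
  then show ?thesis by blast
qed

section \<open>Disintegrated laws and the range property\<close>

text \<open>\<open>KX x\<close> and \<open>KY y\<close> are the conditional laws \<open>\<pi>\<^bsub>X=x\<^esub>\<close> and \<open>\<pi>\<^bsub>Y=y\<^esub>\<close>;
  the classes \<open>banach\<close> and \<open>second_countable_topology\<close> together are the separable Banach spaces.
  The marginals are \<open>distr \<pi> borel fst\<close> on the real line and \<open>distr \<pi> borel snd\<close> on \<open>'y\<close>.\<close>

definition disintegrated_law ::
    "(real \<times> 'y::{banach, second_countable_topology}) measure \<Rightarrow>
     (real \<Rightarrow> 'y measure) \<Rightarrow> ('y \<Rightarrow> real measure) \<Rightarrow> bool" where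
  "disintegrated_law \<pi> KX KY \<longleftrightarrow>
     prob_space \<pi> \<and> sets \<pi> = sets borel \<and>
     KX \<in> borel \<rightarrow>\<^sub>M prob_algebra borel \<and>
     KY \<in> borel \<rightarrow>\<^sub>M prob_algebra borel \<and>
     (\<forall>A\<in>sets borel. emeasure \<pi> A =
        (\<integral>\<^sup>+ x. emeasure (KX x) {y. (x, y) \<in> A} \<partial>distr \<pi> borel fst)) \<and>
     (\<forall>A\<in>sets borel. emeasure \<pi> A =
        (\<integral>\<^sup>+ y. emeasure (KY y) {x. (x, y) \<in> A} \<partial>distr \<pi> borel snd))"

text \<open>Integrable representatives stand for elements of \<open>L\<^sup>1(\<mu>)\<close>, so non-negativity is
  required almost everywhere only. The integral of \<open>g\<close> is taken in \<open>[0, \<infinity>]\<close>, so that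
  the identity also asserts that it is finite almost everywhere.\<close>

definition property_R_plus ::
    "real measure \<Rightarrow> (real \<Rightarrow> 'y::{banach, second_countable_topology} measure) \<Rightarrow> bool" where
  "property_R_plus \<mu> KX \<longleftrightarrow>
     (\<forall>f::real \<Rightarrow> real. integrable \<mu> f \<and> (AE x in \<mu>. 0 \<le> f x) \<longrightarrow>
        (\<exists>g::'y \<Rightarrow> real. g \<in> borel_measurable borel \<and> (\<forall>y. 0 \<le> g y) \<and>
           (AE x in \<mu>. ennreal (f x) = (\<integral>\<^sup>+ y. ennreal (g y) \<partial>KX x))))"

end

theory Submission
  imports Defs
begin

text \<open>If an open set \<open>V\<close> with \<open>\<mu> V < 1\<close> is charged by \<open>\<pi>\<^bsub>Y=y\<^esub>\<close> for \<open>\<nu>\<close>-a.e. \<open>y\<close>, then the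
  indicator of \<open>- V\<close> is not of the form \<open>\<integral> g d\<pi>\<^bsub>X=x\<^esub>\<close> with \<open>g \<ge> 0\<close>: with \<open>B = {g > 0}\<close> such a
  representation gives \<open>\<pi> (V \<times> B) = 0\<close>, so \<open>\<nu> B = 0\<close>, so the indicator vanishes \<open>\<mu>\<close>-a.e.

  For \<open>V\<close> one takes a random translate \<open>U + t\<close> of an open set \<open>U\<close> of finite Lebesgue measure
  that contains the rationals. If an absolutely continuous \<open>a\<close> gives mass \<open>0\<close> to \<open>U + t\<close>
  for all \<open>t\<close> in a set \<open>E\<close>, then it gives mass \<open>0\<close> to \<open>G = (\<Union>t\<in>E. U + t)\<close> by Lindelof; the
  complement of \<open>G\<close> misses \<open>E + \<rat>\<close>, so by continuity of translation it or \<open>E\<close> is a null set, and the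
  former would make \<open>a\<close> vanish. Hence \<open>U + t\<close> is charged by almost every \<open>\<pi>\<^bsub>Y=y\<^esub>\<close> for a.e. \<open>t\<close>,
  whereas \<open>\<mu> (U + t) = 1\<close> for a.e. \<open>t\<close> is impossible because \<open>\<integral> \<mu> (U + t) dt\<close> is the measure of \<open>U\<close>.\<close>

section \<open>Translations and Lebesgue measure on the real line\<close>

lemma emeasure_lborel_translate:
  fixes A :: "real set"
  assumes "A \<in> sets borel"
  shows "emeasure lborel {x. x + c \<in> A} = emeasure lborel A"
proof -
  have "emeasure lborel A = emeasure (distr lborel borel ((+) c)) A"
    by (simp add: lborel_distr_plus)
  also have "\<dots> = emeasure lborel ((+) c -` A)"
    using assms by (subst emeasure_distr) auto
  also have "(+) c -` A = {x. x + c \<in> A}" by (auto simp: add.commute)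
  finally show ?thesis by simp
qed

text \<open>Outer regularity puts \<open>K\<close> into an open \<open>W\<close> of barely larger
  measure, and by compactness all sufficiently small translates of \<open>K\<close> stay inside
  \<open>W\<close>.\<close>

lemma compact_translate_small:
  fixes K :: "real set"
  assumes "compact K" "0 < e"
  shows "\<exists>d>0. \<forall>s. \<bar>s\<bar> < d \<longrightarrow> emeasure lborel ({x. x + s \<in> K} - K) \<le> ennreal e"
proof -
  have K: "K \<in> sets borel" using assms by (auto intro: borel_compact)
  obtain W where W: "open W" "K \<subseteq> W" "emeasure lborel (W - K) < ennreal e"
    using outer_regular_lborel[OF K \<open>0 < e\<close>] by metis
  obtain d where d: "d > 0" "(\<Union>x\<in>K. ball x d) \<subseteq> W"
    using compact_subset_open_imp_ball_epsilon_subset[OF assms(1) W(1,2)] by metis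
  have "emeasure lborel ({x. x + s \<in> K} - K) \<le> ennreal e" if "\<bar>s\<bar> < d" for s
  proof -
    have "{x. x + s \<in> K} \<subseteq> W"
      using d(2) that by (force simp: dist_real_def)
    then have "emeasure lborel ({x. x + s \<in> K} - K) \<le> emeasure lborel (W - K)"
      using W K by (intro emeasure_mono) auto
    with W(3) show ?thesis by simp
  qed
  with d(1) show ?thesis by blast
qed

text \<open>The overlap of \<open>E\<close> with the translate of \<open>K\<close> by
  \<open>- s\<close> is empty for rational \<open>s\<close>, hence null for every real
  \<open>s\<close> by continuity of translation. Integrated over \<open>s\<close>, its measure gives
  the product of the measures of \<open>K\<close> and \<open>E\<close>.\<close>

lemma compact_avoiding_rational_translates:
  fixes K E :: "real set"
  assumes "compact K" and E: "E \<in> sets borel"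
    and disj: "\<And>t q. t \<in> E \<Longrightarrow> q \<in> \<rat> \<Longrightarrow> t + q \<notin> K"
  shows "emeasure lborel K = 0 \<or> emeasure lborel E = 0"
proof -
  have K[measurable]: "K \<in> sets borel" using assms by (auto intro: borel_compact)
  note E[measurable]
  have "emeasure lborel ({x. x + s \<in> K} \<inter> E) \<le> 0 + ennreal e" if "0 < e" for s e
  proof -
    obtain d where d: "d > 0"
      "\<And>r. \<bar>r\<bar> < d \<Longrightarrow> emeasure lborel ({x. x + r \<in> K} - K) \<le> ennreal e"
      using compact_translate_small[OF assms(1) \<open>0 < e\<close>] by blast
    obtain q where q: "q \<in> \<rat>" "s < q" "q < s + d"
      using Rats_dense_in_real[of s "s + d"] d(1) by auto
    let ?D = "{x. x + (s - q) \<in> K} - K"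
    \<comment> \<open>For \<open>x\<close> on the left, \<open>x + q\<close> is outside
      \<open>K\<close> because \<open>x \<in> E\<close> and \<open>q\<close> is rational, while a
      further shift by \<open>s - q\<close> lands in \<open>K\<close>.\<close>
    have "{x. x + s \<in> K} \<inter> E \<subseteq> {x. x + q \<in> ?D}"
      using disj q(1) by auto
    then have "emeasure lborel ({x. x + s \<in> K} \<inter> E) \<le> emeasure lborel {x. x + q \<in> ?D}"
      by (intro emeasure_mono) auto
    also have "\<dots> = emeasure lborel ?D"
      by (intro emeasure_lborel_translate) measurable
    also have "\<dots> \<le> ennreal e" using q by (intro d(2)) auto
    finally show ?thesis by simp
  qed
  then have z: "emeasure lborel ({x. x + s \<in> K} \<inter> E) = 0" for s
    using ennreal_le_epsilon[of 0] by (metis bot.extremum_uniqueI bot_ennreal)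
  \<comment> \<open>Tonelli: for fixed \<open>x \<in> E\<close> the integral over \<open>s\<close>
    is the measure of \<open>K\<close>, by translation invariance.\<close>
  have "0 = (\<integral>\<^sup>+ s. emeasure lborel ({x. x + s \<in> K} \<inter> E) \<partial>lborel)" by (simp add: z)
  also have "\<dots> = (\<integral>\<^sup>+ s. (\<integral>\<^sup>+ x. indicator K (x + s) * indicator E x \<partial>lborel) \<partial>lborel)"
  proof (intro nn_integral_cong)
    fix s :: real
    have "emeasure lborel ({x. x + s \<in> K} \<inter> E) = (\<integral>\<^sup>+ x. indicator ({x. x + s \<in> K} \<inter> E) x \<partial>lborel)"
      by (subst nn_integral_indicator) auto
    also have "\<dots> = (\<integral>\<^sup>+ x. indicator K (x + s) * indicator E x \<partial>lborel)"
      by (intro nn_integral_cong) (auto simp: indicator_def)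
    finally show "emeasure lborel ({x. x + s \<in> K} \<inter> E) =
      (\<integral>\<^sup>+ x. indicator K (x + s) * indicator E x \<partial>lborel)" .
  qed
  also have "\<dots> = (\<integral>\<^sup>+ x. (\<integral>\<^sup>+ s. indicator K (x + s) * indicator E x \<partial>lborel) \<partial>lborel)"
    by (rule lborel_pair.Fubini') measurable
  also have "\<dots> = (\<integral>\<^sup>+ x. emeasure lborel K * indicator E x \<partial>lborel)"
  proof (intro nn_integral_cong)
    fix x :: real
    have "(\<integral>\<^sup>+ s. indicator K (x + s) * indicator E x \<partial>lborel)
      = (\<integral>\<^sup>+ s. indicator K (x + s) \<partial>lborel) * indicator E x"
      by (rule nn_integral_multc) measurable
    also have "(\<integral>\<^sup>+ s. indicator K (x + s) \<partial>lborel) = (\<integral>\<^sup>+ s. indicator {s. s + x \<in> K} s \<partial>lborel)"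
      by (intro nn_integral_cong) (auto simp: indicator_def add.commute)
    also have "\<dots> = emeasure lborel {s. s + x \<in> K}"
      by (subst nn_integral_indicator) auto
    also have "\<dots> = emeasure lborel K" by (rule emeasure_lborel_translate) measurable
    finally show "(\<integral>\<^sup>+ s. indicator K (x + s) * indicator E x \<partial>lborel) = emeasure lborel K * indicator E x" .
  qed
  also have "\<dots> = emeasure lborel K * emeasure lborel E"
    by (subst nn_integral_cmult_indicator) auto
  finally show ?thesis by simp
qed

section \<open>Null translates of an open set containing the rationals\<close>

lemma open_translate:
  fixes U :: "'a::real_normed_vector set"
  assumes "open U"
  shows "open {x. x - t \<in> U}"
  using open_vimage[OF assms, of "\<lambda>x. x - t"] by (simp add: vimage_def continuous_intros)

text \<open>The set \<open>{x. x - t \<in> U}\<close> is the translate \<open>U + t\<close>. What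
  these translates leave uncovered for \<open>t \<in> E\<close> avoids \<open>E + \<rat>\<close> and
  cannot be Lebesgue-null, since \<open>a\<close> would then vanish; so \<open>E\<close> is
  null.\<close>

lemma ac_translates_null:
  fixes a :: "real measure"
  assumes sa: "sets a = sets borel" and ac: "absolutely_continuous lborel a"
    and nz: "emeasure a UNIV \<noteq> 0"
    and U: "open U" "\<rat> \<subseteq> U"
    and E: "E \<in> sets borel" "\<And>t. t \<in> E \<Longrightarrow> emeasure a {x. x - t \<in> U} = 0"
  shows "emeasure lborel E = 0"
proof -
  let ?F = "(\<lambda>t. {x. x - t \<in> U}) ` E"
  have op: "open {x. x - t \<in> U}" for t by (rule open_translate[OF U(1)])
  \<comment> \<open>\<open>E\<close> may be uncountable, so a countable subfamily with the same
    union is extracted before countable subadditivity applies.\<close>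
  obtain F' where F': "F' \<subseteq> ?F" "countable F'" "\<Union>F' = \<Union>?F"
    using Lindelof[of ?F] op by blast
  define G where "G = \<Union>?F"
  have Gop: "open G" using op by (auto simp: G_def)
  have "\<Union>F' \<in> null_sets a"
  proof -
    have "(\<Union>X\<in>F'. X) \<in> null_sets a"
      using F' E(2) op sa by (intro null_sets_UN' null_setsI) (auto simp: subset_iff)
    then show ?thesis by simp
  qed
  then have G0: "G \<in> null_sets a" using F'(3) by (simp add: G_def)
  have pos: "emeasure lborel (- G) \<noteq> 0"
  proof
    assume "emeasure lborel (- G) = 0"
    then have "- G \<in> null_sets lborel" using Gop by (intro null_setsI) auto
    then have "- G \<in> null_sets a" using ac by (auto simp: absolutely_continuous_def)
    then have "G \<union> - G \<in> null_sets a" using G0 by blast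
    then show False using nz null_setsD1[of UNIV a] by simp
  qed
  \<comment> \<open>The closed set \<open>- G\<close> is exhausted by compact pieces, one of which
    must have positive measure.\<close>
  obtain n :: nat where n: "emeasure lborel (- G \<inter> cball 0 (real n)) \<noteq> 0"
  proof (rule ccontr)
    assume "\<not> thesis"
    then have "emeasure lborel (\<Union>n::nat. - G \<inter> cball 0 (real n)) = 0"
      using that Gop by (intro emeasure_UN_eq_0) auto
    also have "(\<Union>n::nat. - G \<inter> cball 0 (real n)) = - G"
      by (auto simp: real_arch_simple)
    finally show False using pos by simp
  qed
  have "compact (- G \<inter> cball 0 (real n))"
    using Gop by (intro closed_Int_compact) auto
  moreover have "t + q \<notin> - G \<inter> cball 0 (real n)" if "t \<in> E" "q \<in> \<rat>" for t q
    using that U(2) by (auto simp: G_def intro!: bexI[of _ t])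
  ultimately show ?thesis using compact_avoiding_rational_translates[OF _ E(1)] n by blast
qed

text \<open>Existence and uniqueness of the decomposition discharge the definite description, which
  makes the defining property of \<open>ac_component\<close> available.\<close>

lemma lebesgue_decomposition_ac_component:
  assumes "finite_measure M" "sets N = sets M"
  shows "\<exists>S. lebesgue_decomposition N M (ac_component N M) S"
proof -
  obtain A S where AS: "lebesgue_decomposition N M A S"
    using lebesgue_decomposition_ex[OF assms] by blast
  then have "ac_component N M = A"
    unfolding ac_component_def using lebesgue_decomposition_unique by (intro the_equality) blast+
  with AS show ?thesis by blast
qed

text \<open>The absolutely continuous component is dominated by \<open>M\<close>, so translates that
  are null for \<open>M\<close> are null for it, and \<open>ac_translates_null\<close>
  applies.\<close>

lemma ac_component_translates_null:
  fixes M :: "real measure"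
  assumes "finite_measure M" and sM: "sets M = sets borel"
    and nz: "ac_component lborel M \<noteq> null_measure lborel"
    and U: "open U" "\<rat> \<subseteq> U"
    and E: "E \<in> sets borel" "\<And>t. t \<in> E \<Longrightarrow> emeasure M {x. x - t \<in> U} = 0"
  shows "emeasure lborel E = 0"
proof -
  let ?a = "ac_component lborel M"
  obtain S where "lebesgue_decomposition lborel M ?a S"
    using lebesgue_decomposition_ac_component[of M lborel] assms by auto
  then have sa: "sets ?a = sets borel" and ac: "absolutely_continuous lborel ?a"
    and M: "\<And>B. B \<in> sets borel \<Longrightarrow> emeasure M B = emeasure ?a B + emeasure S B"
    using sM by (auto simp: lebesgue_decomposition_def)
  have "emeasure ?a UNIV \<noteq> 0"
  proof
    assume 0: "emeasure ?a UNIV = 0"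
    have "?a = null_measure lborel"
    proof (rule measure_eqI)
      fix B assume "B \<in> sets ?a"
      have "emeasure ?a B \<le> emeasure ?a UNIV" using sa by (intro emeasure_mono) auto
      with 0 show "emeasure ?a B = emeasure (null_measure lborel) B" by simp
    qed (simp add: sa)
    with nz show False by simp
  qed
  moreover have "emeasure ?a {x. x - t \<in> U} = 0" if "t \<in> E" for t
  proof -
    have [measurable]: "U \<in> sets borel" using U(1) by simp
    have "{x. x - t \<in> U} \<in> sets borel" by measurable
    from M[OF this] E(2)[OF that] show ?thesis by simp
  qed
  ultimately show ?thesis using ac_translates_null[OF sa ac _ U E(1)] by blast
qed

section \<open>A translate charged by almost every conditional law\<close>

lemma emeasure_lborel_reflect:
  fixes A :: "real set"
  assumes A: "A \<in> sets borel"
  shows "emeasure lborel {t. x - t \<in> A} = emeasure lborel A"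
proof -
  have "emeasure lborel A = emeasure (distr lborel borel (\<lambda>t. x + (-1) * t)) A"
    by (subst lborel_real_affine[of "-1" x]) (auto simp: density_1)
  also have "\<dots> = emeasure lborel {t. x - t \<in> A}"
    using A by (subst emeasure_distr) (auto simp: vimage_def)
  finally show ?thesis by simp
qed

lemma ex_open_charged_by_kernel:
  fixes \<nu> :: "'y::topological_space measure" and KY :: "'y \<Rightarrow> real measure"
  assumes "prob_space \<mu>" and s\<mu>: "sets \<mu> = sets borel"
    and "prob_space \<nu>" and s\<nu>: "sets \<nu> = sets borel"
    and KY: "KY \<in> borel \<rightarrow>\<^sub>M prob_algebra borel"
    and ac: "AE y in \<nu>. ac_component lborel (KY y) \<noteq> null_measure lborel"
  shows "\<exists>V. open V \<and> emeasure \<mu> V \<noteq> 1 \<and> (AE y in \<nu>. emeasure (KY y) V \<noteq> 0)"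
proof -
  interpret \<mu>: prob_space \<mu> by fact
  interpret \<nu>: prob_space \<nu> by fact
  interpret P: pair_sigma_finite \<nu> lborel ..
  interpret Q: pair_sigma_finite lborel \<mu> ..
  have "(\<rat>::real set) \<in> sets borel" by (simp add: countable_rat sets.countable)
  \<comment> \<open>The rationals are Lebesgue-null, so outer regularity yields an open
    \<open>U\<close> around them of measure below 1.\<close>
  then obtain U :: "real set" where U: "open U" "\<rat> \<subseteq> U" "emeasure lborel (U - \<rat>) < ennreal 1"
    using outer_regular_lborel[of "\<rat>" 1] by (metis zero_less_one)
  have Um[measurable]: "U \<in> sets borel" using U(1) by simp
  have "\<rat> \<in> null_sets (lborel :: real measure)"
    by (rule countable_imp_null_set_lborel) (rule countable_rat)
  then have Ufin: "emeasure lborel U < \<infinity>"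
    using U(3) emeasure_Diff_null_set[of \<rat> lborel U] by (auto simp: less_top intro: less_trans)
  let ?V = "\<lambda>t. {x. x - t \<in> U}"
  have op: "open (?V t)" for t by (rule open_translate[OF U(1)])
  have KYp: "prob_space (KY y)" "sets (KY y) = sets borel" for y
    using measurable_space[OF KY, of y] by (auto simp: space_prob_algebra)
  have KY': "KY \<in> \<nu> \<rightarrow>\<^sub>M subprob_algebra borel"
    using measurable_prob_algebraD[OF KY] s\<nu> by (simp cong: measurable_cong_sets)
  \<comment> \<open>Joint measurability in \<open>(y, t)\<close> allows the two almost-everywhere
    quantifiers to be exchanged below.\<close>
  have meas[measurable]: "(\<lambda>z. emeasure (KY (fst z)) (?V (snd z))) \<in> borel_measurable (\<nu> \<Otimes>\<^sub>M lborel)"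
  proof (rule emeasure_measurable_subprob_algebra2)
    have "(SIGMA z:space (\<nu> \<Otimes>\<^sub>M lborel). ?V (snd z)) =
        {w \<in> space ((\<nu> \<Otimes>\<^sub>M lborel) \<Otimes>\<^sub>M borel). snd w - snd (fst w) \<in> U}"
      by (auto simp: space_pair_measure)
    also have "\<dots> \<in> sets ((\<nu> \<Otimes>\<^sub>M lborel) \<Otimes>\<^sub>M borel)" by measurable
    finally show "(SIGMA z:space (\<nu> \<Otimes>\<^sub>M lborel). ?V (snd z)) \<in> sets ((\<nu> \<Otimes>\<^sub>M lborel) \<Otimes>\<^sub>M borel)" .
  qed (rule measurable_compose[OF measurable_fst KY'])
  have "AE y in \<nu>. AE t in lborel. emeasure (KY y) (?V t) \<noteq> 0"
    using ac
  proof eventually_elim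
    case (elim y)
    let ?E = "{t. emeasure (KY y) (?V t) = 0}"
    have "y \<in> space \<nu>" using sets_eq_imp_space_eq[OF s\<nu>] by simp
    from measurable_compose[OF measurable_Pair1'[OF this] meas]
    have m: "(\<lambda>t. emeasure (KY y) (?V t)) \<in> borel_measurable lborel" by simp
    then have "?E \<in> sets borel" by measurable
    moreover from this have "emeasure lborel ?E = 0"
      using KYp[of y] elim U by (intro ac_component_translates_null[of "KY y" U])
        (auto simp: prob_space.finite_measure)
    ultimately show ?case by (intro AE_I[of _ _ ?E]) auto
  qed
  then have "AE t in lborel. AE y in \<nu>. emeasure (KY y) (?V t) \<noteq> 0"
    by (subst (asm) P.AE_commute) measurable
  \<comment> \<open>Mass 1 for almost every \<open>t\<close> would make the integral of
    \<open>emeasure \<mu> (?V t)\<close> over \<open>t\<close> infinite, whereas Tonelli evaluates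
    it as the finite measure of \<open>U\<close>.\<close>
  moreover have "\<not> (AE t in lborel. emeasure \<mu> (?V t) = 1)"
  proof
    assume 1: "AE t in lborel. emeasure \<mu> (?V t) = 1"
    have "(\<infinity>::ennreal) = (\<integral>\<^sup>+ t. 1 \<partial>(lborel::real measure))" by simp
    also have "\<dots> = (\<integral>\<^sup>+ t. emeasure \<mu> (?V t) \<partial>lborel)"
      using 1 by (intro nn_integral_cong_AE) auto
    also have "\<dots> = (\<integral>\<^sup>+ t. (\<integral>\<^sup>+ x. indicator U (x - t) \<partial>\<mu>) \<partial>lborel)"
    proof (intro nn_integral_cong)
      fix t :: real
      have "emeasure \<mu> (?V t) = (\<integral>\<^sup>+ x. indicator (?V t) x \<partial>\<mu>)"
        using op s\<mu> by (subst nn_integral_indicator) auto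
      also have "\<dots> = (\<integral>\<^sup>+ x. indicator U (x - t) \<partial>\<mu>)"
        by (intro nn_integral_cong) (auto simp: indicator_def)
      finally show "emeasure \<mu> (?V t) = (\<integral>\<^sup>+ x. indicator U (x - t) \<partial>\<mu>)" .
    qed
    also have "\<dots> = (\<integral>\<^sup>+ x. (\<integral>\<^sup>+ t. indicator U (x - t) \<partial>lborel) \<partial>\<mu>)"
    proof -
      have [measurable_cong]: "sets \<mu> = sets borel" by fact
      show ?thesis by (rule Q.Fubini'[symmetric]) measurable
    qed
    also have "\<dots> = (\<integral>\<^sup>+ x. emeasure lborel U \<partial>\<mu>)"
    proof (intro nn_integral_cong)
      fix x :: real
      have "(\<integral>\<^sup>+ t. indicator U (x - t) \<partial>lborel) = (\<integral>\<^sup>+ t. indicator {t. x - t \<in> U} t \<partial>lborel)"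
        by (intro nn_integral_cong) (auto simp: indicator_def)
      also have "\<dots> = emeasure lborel U"
        by (subst nn_integral_indicator) (auto simp: emeasure_lborel_reflect)
      finally show "(\<integral>\<^sup>+ t. indicator U (x - t) \<partial>lborel) = emeasure lborel U" .
    qed
    also have "\<dots> = emeasure lborel U" by (simp add: \<mu>.emeasure_space_1)
    finally show False using Ufin by simp
  qed
  ultimately have "\<exists>t. (AE y in \<nu>. emeasure (KY y) (?V t) \<noteq> 0) \<and> emeasure \<mu> (?V t) \<noteq> 1"
    by (metis (mono_tags, lifting) AE_mp AE_I2)
  then show ?thesis using op by blast
qed

section \<open>Failure of the range property\<close>

lemma not_property_R_plus:
  fixes \<pi> :: "(real \<times> 'y::{banach, second_countable_topology}) measure"
  assumes dis: "disintegrated_law \<pi> KX KY"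
    and ac: "AE y in distr \<pi> borel snd. ac_component lborel (KY y) \<noteq> null_measure lborel"
  shows "\<not> property_R_plus (distr \<pi> borel fst) KX"
proof
  assume R: "property_R_plus (distr \<pi> borel fst) KX"
  define \<mu> where "\<mu> = distr \<pi> borel fst"
  define \<nu> where "\<nu> = distr \<pi> borel snd"
  have s\<pi>[measurable_cong]: "sets \<pi> = sets borel" and KX: "KX \<in> borel \<rightarrow>\<^sub>M prob_algebra borel"
    and KY: "KY \<in> borel \<rightarrow>\<^sub>M prob_algebra borel"
    and dX: "\<And>A. A \<in> sets borel \<Longrightarrow> emeasure \<pi> A = (\<integral>\<^sup>+ x. emeasure (KX x) {y. (x, y) \<in> A} \<partial>\<mu>)"
    and dY: "\<And>A. A \<in> sets borel \<Longrightarrow> emeasure \<pi> A = (\<integral>\<^sup>+ y. emeasure (KY y) {x. (x, y) \<in> A} \<partial>\<nu>)"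
    using dis by (auto simp: disintegrated_law_def \<mu>_def \<nu>_def)
  interpret \<pi>: prob_space \<pi> using dis by (simp add: disintegrated_law_def)
  have fs: "fst \<in> \<pi> \<rightarrow>\<^sub>M borel" "snd \<in> \<pi> \<rightarrow>\<^sub>M borel"
    by (simp_all add: borel_prod[symmetric] measurable_cong_sets[OF s\<pi>])
  interpret \<mu>: prob_space \<mu> unfolding \<mu>_def by (rule \<pi>.prob_space_distr[OF fs(1)])
  interpret \<nu>: prob_space \<nu> unfolding \<nu>_def by (rule \<pi>.prob_space_distr[OF fs(2)])
  have s\<mu>[measurable_cong]: "sets \<mu> = sets borel" and s\<nu>[measurable_cong]: "sets \<nu> = sets borel"
    by (simp_all add: \<mu>_def \<nu>_def)
  obtain V where V: "open V" "emeasure \<mu> V \<noteq> 1" "AE y in \<nu>. emeasure (KY y) V \<noteq> 0"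
    using ex_open_charged_by_kernel[OF \<mu>.prob_space_axioms s\<mu> \<nu>.prob_space_axioms s\<nu> KY] ac
    unfolding \<nu>_def by blast
  have Vm[measurable]: "V \<in> sets borel" using V(1) by simp
  have sKX: "sets (KX x) = sets borel" for x
    using measurable_space[OF KX, of x] by (auto simp: space_prob_algebra)
  have mKX: "(\<lambda>x. emeasure (KX x) C) \<in> borel_measurable \<mu>" if "C \<in> sets borel" for C
    using measurable_compose[OF measurable_prob_algebraD[OF KX] measurable_emeasure_subprob_algebra[OF that]]
    by (simp cong: measurable_cong_sets add: s\<mu>)
  have mKY: "(\<lambda>y. emeasure (KY y) C) \<in> borel_measurable \<nu>" if "C \<in> sets borel" for C
    using measurable_compose[OF measurable_prob_algebraD[OF KY] measurable_emeasure_subprob_algebra[OF that]]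
    by (simp cong: measurable_cong_sets add: s\<nu>)
  define f :: "real \<Rightarrow> real" where "f = indicator (- V)"
  have "integrable \<mu> f"
    unfolding f_def using V(1) s\<mu> by (intro \<mu>.integrable_const_bound[of _ 1]) auto
  moreover have "AE x in \<mu>. 0 \<le> f x" by (simp add: f_def)
  ultimately obtain g :: "'y \<Rightarrow> real" where g[measurable]: "g \<in> borel_measurable borel"
    and g0: "\<And>y. 0 \<le> g y" and fg: "AE x in \<mu>. ennreal (f x) = (\<integral>\<^sup>+ y. ennreal (g y) \<partial>KX x)"
    using R unfolding property_R_plus_def \<mu>_def[symmetric] by blast
  define B where "B = {y. g y \<noteq> 0}"
  have B[measurable]: "B \<in> sets borel" unfolding B_def by measurable
  \<comment> \<open>Since \<open>g\<close> is non-negative, whether its integral vanishes depends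
    only on the mass of \<open>B\<close>.\<close>
  have KXB: "(\<integral>\<^sup>+ y. ennreal (g y) \<partial>KX x) = 0 \<longleftrightarrow> emeasure (KX x) B = 0" for x
  proof -
    have "g \<in> borel_measurable (KX x)" using g by (simp cong: measurable_cong_sets add: sKX)
    moreover have "{y \<in> space (KX x). ennreal (g y) \<noteq> 0} = B"
      using g0 sets_eq_imp_space_eq[OF sKX[of x]] by (auto simp: B_def ennreal_eq_0_iff intro: antisym)
    ultimately show ?thesis by (subst nn_integral_0_iff) auto
  qed
  have VB: "V \<times> B \<in> sets borel" "(UNIV :: real set) \<times> B \<in> sets borel"
    by (simp_all add: borel_prod[symmetric] pair_measureI del: borel_prod)
  \<comment> \<open>For \<open>x \<in> V\<close> the value \<open>f x\<close> is 0, so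
    \<open>KX x\<close> does not charge \<open>B\<close>; for other \<open>x\<close> the section is
    empty.\<close>
  have "emeasure \<pi> (V \<times> B) = (\<integral>\<^sup>+ x. 0 \<partial>\<mu>)"
    unfolding dX[OF VB(1)]
  proof (intro nn_integral_cong_AE)
    show "AE x in \<mu>. emeasure (KX x) {y. (x, y) \<in> V \<times> B} = 0"
      using fg
    proof eventually_elim
      case (elim x)
      show ?case
      proof (cases "x \<in> V")
        case True
        with elim KXB[of x] show ?thesis by (simp add: f_def)
      qed simp
    qed
  qed
  \<comment> \<open>The same rectangle is measured through \<open>KY\<close>. Almost every
    \<open>KY y\<close> charges \<open>V\<close>, so the vanishing mass forces \<open>B\<close> to
    be \<open>\<nu>\<close>-null.\<close>
  also have "emeasure \<pi> (V \<times> B) = (\<integral>\<^sup>+ y. emeasure (KY y) V * indicator B y \<partial>\<nu>)"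
    unfolding dY[OF VB(1)] by (intro nn_integral_cong) (auto simp: indicator_def)
  finally have "(\<integral>\<^sup>+ y. emeasure (KY y) V * indicator B y \<partial>\<nu>) = 0" by simp
  then have "AE y in \<nu>. emeasure (KY y) V * indicator B y = 0"
    using mKY[OF Vm] by (subst (asm) nn_integral_0_iff_AE) auto
  with V(3) have "AE y in \<nu>. y \<notin> B"
    by eventually_elim (auto simp: indicator_def split: if_splits)
  then have "emeasure \<nu> B = 0"
    using AE_iff_measurable[of B \<nu> "\<lambda>y. y \<notin> B"] sets_eq_imp_space_eq[OF s\<nu>] s\<nu> by auto
  moreover have "emeasure \<nu> B = emeasure \<pi> (UNIV \<times> B)"
    unfolding \<nu>_def using sets_eq_imp_space_eq[OF s\<pi>]
    by (subst emeasure_distr[OF fs(2)]) (auto intro!: arg_cong[where f="emeasure \<pi>"])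
  \<comment> \<open>Back to \<open>KX\<close>: almost every \<open>KX x\<close> gives
    \<open>B\<close> mass 0, so \<open>f\<close> vanishes almost everywhere and \<open>V\<close> has
    full mass.\<close>
  ultimately have "(\<integral>\<^sup>+ x. emeasure (KX x) B \<partial>\<mu>) = 0"
    using dX[OF VB(2)] by simp
  then have "AE x in \<mu>. emeasure (KX x) B = 0"
    using mKX[OF B] by (subst (asm) nn_integral_0_iff_AE) auto
  with fg have "AE x in \<mu>. x \<in> V"
  proof eventually_elim
    case (elim x)
    then have "ennreal (f x) = 0" using KXB[of x] by simp
    then show ?case by (auto simp: f_def indicator_def split: if_splits)
  qed
  then have "emeasure \<mu> V = 1"
    using \<mu>.emeasure_eq_1_AE[of V] s\<mu> by simp
  with V(2) show False by simp
qed

section \<open>Laws with a Lebesgue density\<close>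

lemma emeasure_greaterThan_le:
  fixes M N :: "real measure"
  assumes sM: "sets M = sets borel" and sN: "sets N = sets borel"
    and eq: "\<And>q. q \<in> \<rat> \<Longrightarrow> emeasure M {q<..} = emeasure N {q<..}"
  shows "emeasure M {x<..} \<le> emeasure N {x<..}"
proof -
  \<comment> \<open>The half-lines \<open>{x + d n<..}\<close> increase to \<open>{x<..}\<close>,
    and between \<open>x\<close> and \<open>x + d n\<close> there is a rational at which the
    measures can be compared.\<close>
  define d where "d n = 1 / real (Suc n)" for n
  have dpos: "0 < d n" for n by (simp add: d_def)
  have "d (Suc n) \<le> d n" for n unfolding d_def by (rule divide_left_mono) auto
  then have inc: "incseq (\<lambda>n. {x + d n<..})"
    by (intro incseq_SucI) simp
  have un: "(\<Union>n. {x + d n<..}) = {x<..}"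
  proof (intro antisym subsetI)
    fix z assume "z \<in> {x<..}"
    then have "0 < z - x" by simp
    then obtain n where "1 / real (Suc n) < z - x" by (rule nat_approx_posE)
    then have "z \<in> {x + d n<..}" unfolding d_def greaterThan_iff by linarith
    then show "z \<in> (\<Union>n. {x + d n<..})" by blast
  next
    fix z assume "z \<in> (\<Union>n. {x + d n<..})"
    then obtain n where "x + d n < z" by auto
    with dpos[of n] show "z \<in> {x<..}" by simp
  qed
  have "range (\<lambda>n. {x + d n<..}) \<subseteq> sets M"
    by (intro image_subsetI) (simp only: sM borel_open open_greaterThan)
  from SUP_emeasure_incseq[OF this inc]
  have "emeasure M {x<..} = (SUP n. emeasure M {x + d n<..})"
    unfolding un by (rule sym)
  also have "\<dots> \<le> emeasure N {x<..}"
  proof (rule SUP_least)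
    fix n :: nat
    obtain q where q: "q \<in> \<rat>" "x < q" "q < x + d n"
      using Rats_dense_in_real[of x "x + d n"] dpos[of n] by (metis less_add_same_cancel1)
    have "emeasure M {x + d n<..} \<le> emeasure M {q<..}"
      using q sM by (intro emeasure_mono) auto
    also have "\<dots> = emeasure N {q<..}" by (rule eq[OF q(1)])
    also have "\<dots> \<le> emeasure N {x<..}" using q sN by (intro emeasure_mono) auto
    finally show "emeasure M {x + d n<..} \<le> emeasure N {x<..}" .
  qed
  finally show ?thesis .
qed

text \<open>With rational half-lines as tests, only countably many almost-everywhere identities have
  to be combined when conditional laws are compared.\<close>

lemma measure_eqI_greaterThan_Rats:
  fixes M N :: "real measure"
  assumes "finite_measure M" "sets M = sets borel" "sets N = sets borel"
    and "\<And>q. q \<in> \<rat> \<Longrightarrow> emeasure M {q<..} = emeasure N {q<..}"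
  shows "M = N"
proof (rule measure_eqI_lessThan)
  fix x
  show "emeasure M {x<..} < \<infinity>"
    using finite_measure.emeasure_finite[OF assms(1), of "{x<..}"] by (simp add: less_top[symmetric])
  show "emeasure M {x<..} = emeasure N {x<..}"
    by (rule antisym; rule emeasure_greaterThan_le) (simp_all add: assms)
qed (rule assms)+

text \<open>\<open>M\<close> with zero singular part is a decomposition, and uniqueness identifies
  it with the chosen one.\<close>

lemma ac_component_absolutely_continuous:
  assumes "absolutely_continuous N M" "sets N = sets M"
  shows "ac_component N M = M"
proof -
  have "lebesgue_decomposition N M M (null_measure M)"
    unfolding lebesgue_decomposition_def mutually_singular_def
  proof (intro conjI ballI)
    show "\<exists>Z\<in>sets N. emeasure N Z = 0 \<and> emeasure (null_measure M) (space N - Z) = 0"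
      by (intro bexI[of _ "{}"]) simp_all
  qed (simp_all add: assms)
  then show ?thesis
    unfolding ac_component_def using lebesgue_decomposition_unique by (intro the_equality) blast+
qed

text \<open>This is the conditional density formula: for \<open>\<nu>\<close>-almost every
  \<open>y\<close>, where \<open>\<nu>\<close> is the second marginal, \<open>KY y\<close> has
  density \<open>p (x, y)\<close> in \<open>x\<close> divided by the marginal density at
  \<open>y\<close>.\<close>

lemma disintegration_density_ac:
  fixes \<pi> :: "(real \<times> 'y::euclidean_space) measure"
  assumes "prob_space \<pi>" and KY: "KY \<in> borel \<rightarrow>\<^sub>M prob_algebra borel"
    and dis: "\<And>A. A \<in> sets borel \<Longrightarrow>
        emeasure \<pi> A = (\<integral>\<^sup>+ y. emeasure (KY y) {x. (x, y) \<in> A} \<partial>distr \<pi> borel snd)"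
    and p: "p \<in> borel_measurable lborel" and \<pi>: "\<pi> = density lborel p"
  shows "AE y in distr \<pi> borel snd. absolutely_continuous lborel (KY y)"
proof -
  interpret \<pi>: prob_space \<pi> by fact
  have KYp: "prob_space (KY y)" "sets (KY y) = sets borel" for y
    using measurable_space[OF KY, of y] by (auto simp: space_prob_algebra)
  have mKY[measurable]: "(\<lambda>y. emeasure (KY y) C) \<in> borel_measurable borel" if "C \<in> sets borel" for C
    by (rule measurable_compose[OF measurable_prob_algebraD[OF KY] measurable_emeasure_subprob_algebra[OF that]])
  have pm[measurable]: "p \<in> borel_measurable (borel \<Otimes>\<^sub>M borel)"
    using p by (simp add: borel_prod)
  \<comment> \<open>\<open>I C\<close> is the density of the measure sending \<open>B\<close> to
    \<open>emeasure \<pi> (C \<times> B)\<close>; in particular \<open>I UNIV\<close> is the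
    marginal density.\<close>
  define I where "I C y = (\<integral>\<^sup>+ x. p (x, y) * indicator C x \<partial>lborel)" for C y
  have Im[measurable]: "I C \<in> borel_measurable borel" if [measurable]: "C \<in> sets borel" for C
    unfolding I_def by measurable
  have rect: "emeasure \<pi> (C \<times> B) = (\<integral>\<^sup>+ y. I C y * indicator B y \<partial>lborel)"
    if [measurable]: "C \<in> sets borel" "B \<in> sets borel" for C B
  proof -
    have "C \<times> B \<in> sets borel"
      by (simp add: borel_prod[symmetric] pair_measureI that del: borel_prod)
    then have "emeasure \<pi> (C \<times> B) = (\<integral>\<^sup>+ z. p z * indicator (C \<times> B) z \<partial>lborel)"
      unfolding \<pi> using p by (intro emeasure_density) auto
    also have "\<dots> = (\<integral>\<^sup>+ z. p z * indicator (C \<times> B) z \<partial>(lborel \<Otimes>\<^sub>M lborel))"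
      by (simp add: lborel_prod)
    also have "\<dots> = (\<integral>\<^sup>+ y. (\<integral>\<^sup>+ x. p (x, y) * indicator (C \<times> B) (x, y) \<partial>lborel) \<partial>lborel)"
      by (rule lborel_pair.nn_integral_snd[symmetric]) measurable
    also have "\<dots> = (\<integral>\<^sup>+ y. I C y * indicator B y \<partial>lborel)"
      unfolding I_def by (intro nn_integral_cong) (auto simp: indicator_def)
    finally show ?thesis .
  qed
  define \<nu> where "\<nu> = distr \<pi> borel snd"
  have sndm: "snd \<in> \<pi> \<rightarrow>\<^sub>M borel"
    using measurable_snd[of "borel :: real measure" "borel :: 'y measure"]
    by (simp add: \<pi> borel_prod)
  have \<nu>: "\<nu> = density lborel (I UNIV)"
  proof (rule measure_eqI)
    fix B assume "B \<in> sets \<nu>"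
    then have B[measurable]: "B \<in> sets borel" by (simp add: \<nu>_def)
    have "emeasure \<nu> B = emeasure \<pi> (UNIV \<times> B)"
      unfolding \<nu>_def using B
      by (subst emeasure_distr[OF sndm]) (auto simp: \<pi> intro!: arg_cong[where f="emeasure (density lborel p)"])
    also have "\<dots> = emeasure (density lborel (I UNIV)) B"
      by (subst rect) (auto simp: emeasure_density)
    finally show "emeasure \<nu> B = emeasure (density lborel (I UNIV)) B" .
  qed (simp add: \<nu>_def)
  \<comment> \<open>Both sides are densities of the same measure, hence agree almost everywhere,
    with an exceptional set depending on \<open>C\<close>.\<close>
  have cond: "AE y in lborel. I UNIV y * emeasure (KY y) C = I C y" if C[measurable]: "C \<in> sets borel" for C
  proof (rule sigma_finite_measure.density_unique[OF sigma_finite_lborel])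
    show "density lborel (\<lambda>y. I UNIV y * emeasure (KY y) C) = density lborel (I C)"
    proof (rule measure_eqI)
      fix B :: "'y set" assume "B \<in> sets (density lborel (\<lambda>y. I UNIV y * emeasure (KY y) C))"
      then have B[measurable]: "B \<in> sets borel" by simp
      have "C \<times> B \<in> sets borel"
        by (simp add: borel_prod[symmetric] pair_measureI B C del: borel_prod)
      from dis[OF this]
      have "emeasure \<pi> (C \<times> B) = (\<integral>\<^sup>+ y. emeasure (KY y) {x. (x, y) \<in> C \<times> B} \<partial>\<nu>)"
        by (simp add: \<nu>_def)
      also have "\<dots> = (\<integral>\<^sup>+ y. emeasure (KY y) C * indicator B y \<partial>\<nu>)"
        by (intro nn_integral_cong) (auto simp: indicator_def)
      also have "\<dots> = (\<integral>\<^sup>+ y. I UNIV y * (emeasure (KY y) C * indicator B y) \<partial>lborel)"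
        unfolding \<nu> by (rule nn_integral_density) auto
      also have "\<dots> = emeasure (density lborel (\<lambda>y. I UNIV y * emeasure (KY y) C)) B"
        by (subst emeasure_density) (auto simp: mult.assoc)
      finally show "emeasure (density lborel (\<lambda>y. I UNIV y * emeasure (KY y) C)) B
          = emeasure (density lborel (I C)) B"
        using rect[OF C B] by (simp add: emeasure_density)
    qed simp
  qed measurable
  have "AE y in lborel. \<forall>q\<in>\<rat>. I UNIV y * emeasure (KY y) {q<..} = I {q<..} y"
    using cond by (intro AE_ball_countable' countable_rat) simp
  \<comment> \<open>Finiteness of the marginal density permits the division by
    \<open>I UNIV y\<close>.\<close>
  moreover have "AE y in lborel. I UNIV y \<noteq> \<infinity>"
  proof (rule nn_integral_PInf_AE)
    have "(\<integral>\<^sup>+ y. I UNIV y \<partial>lborel) = emeasure \<pi> (UNIV \<times> UNIV)"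
      by (subst rect) auto
    then show "(\<integral>\<^sup>+ y. I UNIV y \<partial>lborel) \<noteq> \<infinity>" by simp
  qed measurable
  ultimately have "AE y in lborel. 0 < I UNIV y \<longrightarrow> absolutely_continuous lborel (KY y)"
  proof eventually_elim
    case (elim y)
    show ?case
    proof
      assume pos: "0 < I UNIV y"
      have [measurable]: "(\<lambda>x. p (x, y)) \<in> borel_measurable borel" by measurable
      have "KY y = density lborel (\<lambda>x. p (x, y) / I UNIV y)"
      proof (rule measure_eqI_greaterThan_Rats)
        fix q :: real assume "q \<in> \<rat>"
        with elim have "I {q<..} y = I UNIV y * emeasure (KY y) {q<..}" by simp
        moreover have "emeasure (density lborel (\<lambda>x. p (x, y) / I UNIV y)) {q<..}
            = (\<integral>\<^sup>+ x. p (x, y) * indicator {q<..} x / I UNIV y \<partial>lborel)"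
          by (subst emeasure_density)
             (auto intro!: nn_integral_cong simp: indicator_def)
        moreover have "\<dots> = I {q<..} y / I UNIV y"
          unfolding I_def by (rule nn_integral_divide) measurable
        ultimately show "emeasure (KY y) {q<..} = emeasure (density lborel (\<lambda>x. p (x, y) / I UNIV y)) {q<..}"
          using ennreal_mult_divide_eq[of "I UNIV y" "emeasure (KY y) {q<..}"] pos elim
          by (simp add: mult.commute)
      qed (use KYp[of y] in \<open>auto simp: prob_space.finite_measure\<close>)
      then show "absolutely_continuous lborel (KY y)"
        by (simp add: absolutely_continuousI_density)
    qed
  qed
  \<comment> \<open>Points with \<open>I UNIV y = 0\<close> form a \<open>\<nu>\<close>-null
    set.\<close>
  then show ?thesis
    unfolding \<nu>_def[symmetric] \<nu> by (subst AE_density) auto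
qed

theorem corollary2p9:
  shows "(\<forall>(\<pi> :: (real \<times> 'y::{banach, second_countable_topology}) measure) KX KY.
            disintegrated_law \<pi> KX KY \<longrightarrow>
            (AE y in distr \<pi> borel snd. ac_component lborel (KY y) \<noteq> null_measure lborel) \<longrightarrow>
            \<not> property_R_plus (distr \<pi> borel fst) KX)
       \<and> (\<forall>(\<pi> :: (real \<times> (real ^ 'd)) measure) KX KY.
            disintegrated_law \<pi> KX KY \<longrightarrow>
            (\<exists>p\<in>borel_measurable lborel. \<pi> = density lborel p) \<longrightarrow>
            (AE y in distr \<pi> borel snd. ac_component lborel (KY y) \<noteq> null_measure lborel) \<and>
            \<not> property_R_plus (distr \<pi> borel fst) KX)"
proof (intro conjI allI impI)
  fix \<pi> :: "(real \<times> 'y) measure" and KX KY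
  assume "disintegrated_law \<pi> KX KY"
    and "AE y in distr \<pi> borel snd. ac_component lborel (KY y) \<noteq> null_measure lborel"
  then show "\<not> property_R_plus (distr \<pi> borel fst) KX" by (rule not_property_R_plus)
next
  fix \<pi> :: "(real \<times> (real ^ 'd)) measure" and KX KY
  assume dis: "disintegrated_law \<pi> KX KY" and "\<exists>p\<in>borel_measurable lborel. \<pi> = density lborel p"
  then have "AE y in distr \<pi> borel snd. absolutely_continuous lborel (KY y)"
    using disintegration_density_ac[of \<pi> KY] by (auto simp: disintegrated_law_def)
  then show ac: "AE y in distr \<pi> borel snd. ac_component lborel (KY y) \<noteq> null_measure lborel"
  proof eventually_elim
    case (elim y)
    have "KY \<in> borel \<rightarrow>\<^sub>M prob_algebra borel" using dis by (simp add: disintegrated_law_def)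
    from measurable_space[OF this, of y]
    have KY: "prob_space (KY y)" "sets (KY y) = sets borel" by (auto simp: space_prob_algebra)
    \<comment> \<open>The conditional law is its own absolutely continuous component, and its total
      mass 1 excludes the zero measure.\<close>
    then have "ac_component lborel (KY y) = KY y"
      using elim by (intro ac_component_absolutely_continuous) auto
    moreover have "KY y \<noteq> null_measure lborel"
      using prob_space.emeasure_space_1[OF KY(1)] by auto
    ultimately show ?case by simp
  qed
  show "\<not> property_R_plus (distr \<pi> borel fst) KX" by (rule not_property_R_plus[OF dis ac])
qed

end
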